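(* For all $k$ there is a directed Cayley graph of an Abelian group on three generators which has diameter $k$ and size at least $0.084\,k^3 + O(k^2)$. (That is, there is a function $f(k) = O(k^2)$, as $k\to\infty$, such that for every $k$ such a graph exists with diameter $k$ and at least $0.084\,k^3 + f(k)$ vertices.)
   Context: Given an Abelian group $G$ (written additively) generated by a list of elements $g_1,\dots,g_d$, the directed Cayley graph of $G$ on these $d$ generators has vertex set $G$, with a directed edge from $x$ to $y$ iff $y = x + g_i$ for some $i$. Its size is $|G|$. Its diameter is the maximum, over ordered pairs of vertices, of the directed path distance, i.e. the least $k$ such that every element of $G$ is a sum of at most $k$ terms (with repetition) from $g_1,\dots,g_d$. Here $k$ ranges over nonnegative integers. *)

theory Defs
  imports
    "HOL-Algebra.Generated_Groups"
    "HOL-Library.Landau_Symbols"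
    "Graph_Theory.Shortest_Path"
begin

text \<open>Groups are written multiplicatively, as in HOL-Algebra. Arcs are pairs of vertices, so
  a repeated generator does not produce parallel arcs.\<close>

definition cayley_digraph :: "('a, 'm) monoid_scheme \<Rightarrow> 'a list \<Rightarrow> ('a, 'a \<times> 'a) pre_digraph" where
  "cayley_digraph G gs =
     \<lparr>verts = carrier G,
      arcs = {(x, y). x \<in> carrier G \<and> (\<exists>g \<in> set gs. y = x \<otimes>\<^bsub>G\<^esub> g)},
      tail = fst,
      head = snd\<rparr>"

lemma (in monoid) wf_digraph_cayley_digraph:
  assumes "set gs \<subseteq> carrier G"
  shows "wf_digraph (cayley_digraph G gs)"
  using assms by unfold_locales (auto simp: cayley_digraph_def)

text \<open>With all arc weights equal to 1, the shortest-path cost \<open>\<mu>\<close> is the path distance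
  (\<open>\<infinity>\<close> for an unreachable pair). Distances are natural numbers or \<open>\<infinity>\<close>, so if
  the supremum is a natural number, it is attained.\<close>

definition (in wf_digraph) digraph_diameter :: ereal where
  "digraph_diameter = (SUP (x, y) \<in> verts G \<times> verts G. \<mu> (\<lambda>_. 1) x y)"

end

theory Submission
  imports Defs "HOL-Library.Product_Plus" "HOL-Library.Countable"
begin

text \<open>The three residues 2, 9, 35 generate the integers modulo 84 with diameter 7; the residue 77
  is a sum of at most seven of them only as 7 times 35. Let \<open>L\<close> be the lattice of the integer triples
  \<open>(x, y, z)\<close> with \<open>2 x + 9 y + 35 z\<close> divisible by 84, and stretch it by factors
  \<open>t1, t2 \<le> t3\<close> along the axes. A triple in the stretched grid consists of its coordinatewise quotients
  by the factors, which matter only modulo \<open>L\<close>, and its remainders, which contribute at most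
  \<open>t1 + t2 + t3 - 3\<close>. The quotients cost at most \<open>7 t3\<close>, and
  exactly that for the residue 77 if the factors are nearly equal. So the quotient
  group has diameter \<open>t1 + t2 + 8 t3 - 3\<close> and order \<open>84 t1 t2 t3\<close>. Taking \<open>t2 = t3\<close> about
  \<open>k / 10\<close> and adjusting \<open>t1\<close> by at most 9 realises every large diameter \<open>k\<close>. For small \<open>k\<close> the bound
  is made negative by the error term, and a cyclic group suffices.\<close>

section \<open>Cayley graphs of quotients presented by a map\<close>

text \<open>A map whose fibres are translation invariant presents a quotient of its domain;
  the values of the map serve as names for the cosets.\<close>

locale translation_congruence =
  fixes \<phi> :: "'c::ab_group_add \<Rightarrow> 'a" and es :: "'c list"
  assumes cong_add_right: "\<phi> x = \<phi> y \<Longrightarrow> \<phi> (x + z) = \<phi> (y + z)"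
begin

text \<open>Cosets are multiplied through preimages picked by \<open>inv_into\<close>; by
  \<open>cong_add_right\<close> the pick does not affect the product.\<close>

definition image_group :: "'a monoid" where
  "image_group = \<lparr>carrier = range \<phi>,
     mult = (\<lambda>a b. \<phi> (inv_into UNIV \<phi> a + inv_into UNIV \<phi> b)), one = \<phi> 0\<rparr>"

lemma carrier_image_group [simp]: "carrier image_group = range \<phi>"
  by (simp add: image_group_def)

lemma one_image_group [simp]: "\<one>\<^bsub>image_group\<^esub> = \<phi> 0"
  by (simp add: image_group_def)

lemma mult_image_group [simp]: "\<phi> x \<otimes>\<^bsub>image_group\<^esub> \<phi> y = \<phi> (x + y)"
proof -
  let ?r = "\<lambda>x. inv_into UNIV \<phi> (\<phi> x)"
  have r: "\<phi> (?r x) = \<phi> x" for x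
    by (simp add: f_inv_into_f)
  \<comment> \<open>The congruence changes only the left summand, so the two representatives are
    exchanged one after the other, with a commutation in between.\<close>
  have "\<phi> (?r x + ?r y) = \<phi> (?r y + x)"
    using cong_add_right[OF r, of x "?r y"] by (simp add: add.commute)
  also have "\<dots> = \<phi> (y + x)"
    by (intro cong_add_right r)
  finally show ?thesis
    by (simp add: image_group_def add.commute)
qed

lemma comm_group_image_group: "comm_group image_group"
proof (rule comm_groupI)
  fix a assume "a \<in> carrier image_group"
  then obtain x where "a = \<phi> x" by auto
  then show "\<exists>b\<in>carrier image_group. b \<otimes>\<^bsub>image_group\<^esub> a = \<one>\<^bsub>image_group\<^esub>"
    by (intro bexI[of _ "\<phi> (- x)"]) auto
qed (auto simp: add.assoc, metis add.commute)

sublocale image_group: comm_group image_group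
  by (rule comm_group_image_group)

sublocale cayley: wf_digraph "cayley_digraph image_group (map \<phi> es)"
  by (rule image_group.wf_digraph_cayley_digraph) auto

lemma verts_cayley [simp]: "verts (cayley_digraph image_group (map \<phi> es)) = range \<phi>"
  by (simp add: cayley_digraph_def)

text \<open>Arcs carry no generator label, so a generator is chosen for each arc. The start
  \<open>x\<close> is arbitrary because the rest of the walk starts at \<open>x + e\<close>.\<close>

lemma awalk_imp_word:
  assumes "cayley.awalk (\<phi> x) p v"
  shows "\<exists>ws. set ws \<subseteq> set es \<and> length ws = length p \<and> v = \<phi> (x + sum_list ws)"
  using assms
proof (induction p arbitrary: x)
  case Nil
  then show ?case
    by (auto simp: cayley.awalk_Nil_iff)
next
  case (Cons arc p)
  then have arc: "arc \<in> arcs (cayley_digraph image_group (map \<phi> es))" "fst arc = \<phi> x"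
    and p: "cayley.awalk (snd arc) p v"
    by (simp_all add: cayley.awalk_Cons_iff) (simp_all add: cayley_digraph_def)
  from arc obtain e where "e \<in> set es" "snd arc = fst arc \<otimes>\<^bsub>image_group\<^esub> \<phi> e"
    by (auto simp: cayley_digraph_def simp del: mult_image_group)
  with arc(2) have e: "e \<in> set es" "snd arc = \<phi> (x + e)"
    by simp_all
  with p Cons.IH[of "x + e"] obtain ws where
    "set ws \<subseteq> set es" "length ws = length p" "v = \<phi> (x + e + sum_list ws)"
    by auto
  with e show ?case
    by (intro exI[of _ "e # ws"]) (simp add: add.assoc)
qed

lemma word_imp_awalk:
  assumes "set ws \<subseteq> set es"
  shows "\<exists>p. length p = length ws \<and> cayley.awalk (\<phi> x) p (\<phi> (x + sum_list ws))"
  using assms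
proof (induction ws arbitrary: x)
  case Nil
  then show ?case
    by (simp add: cayley.awalk_Nil_iff)
next
  case (Cons e ws)
  then obtain p where p: "length p = length ws"
    "cayley.awalk (\<phi> (x + e)) p (\<phi> (x + e + sum_list ws))"
    by fastforce
  have "cayley.awalk (\<phi> x) ((\<phi> x, \<phi> (x + e)) # p) (\<phi> (x + e + sum_list ws))"
    using p(2) Cons.prems unfolding cayley.awalk_Cons_iff
    by (auto simp: cayley_digraph_def intro!: bexI[of _ e])
  with p(1) show ?case
    by (intro exI[of _ "(\<phi> x, \<phi> (x + e)) # p"]) (simp add: add.assoc)
qed

lemma awalk_cost_1: "cayley.awalk_cost (\<lambda>_. 1) p = real (length p)"
  by (simp add: cayley.awalk_cost_def sum_list_triv)

text \<open>The graph is invariant under translation: the distance from \<open>\<phi> x\<close> to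
  \<open>\<phi> y\<close> is the distance from \<open>\<phi> 0\<close> to
  \<open>\<phi> (y - x)\<close>. So single elements suffice for the upper bound, and one far element
  \<open>x0\<close> for the lower bound.\<close>

lemma digraph_diameter_eqI:
  assumes upper: "\<And>x. \<exists>ws. set ws \<subseteq> set es \<and> length ws \<le> k \<and> \<phi> x = \<phi> (sum_list ws)"
    and lower: "\<And>ws. set ws \<subseteq> set es \<Longrightarrow> \<phi> x0 = \<phi> (sum_list ws) \<Longrightarrow> k \<le> length ws"
  shows "cayley.digraph_diameter = ereal (real k)"
proof (rule antisym)
  show "cayley.digraph_diameter \<le> ereal (real k)"
    unfolding cayley.digraph_diameter_def
  proof (safe intro!: SUP_least)
    fix a b
    assume "a \<in> verts (cayley_digraph image_group (map \<phi> es))"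
      "b \<in> verts (cayley_digraph image_group (map \<phi> es))"
    then obtain x y where xy: "a = \<phi> x" "b = \<phi> y" by auto
    obtain ws where ws: "set ws \<subseteq> set es" "length ws \<le> k" "\<phi> (y - x) = \<phi> (sum_list ws)"
      using upper by blast
    from ws(3) have "\<phi> (y - x + x) = \<phi> (sum_list ws + x)"
      by (rule cong_add_right)
    then have "b = \<phi> (x + sum_list ws)"
      by (simp add: xy add.commute)
    with word_imp_awalk[OF ws(1), of x] obtain p where
      p: "length p = length ws" "cayley.awalk a p b"
      by (auto simp: xy)
    have "cayley.\<mu> (\<lambda>_. 1) a b \<le> ereal (cayley.awalk_cost (\<lambda>_. 1) p)"
      by (rule cayley.min_cost_le_walk_cost[OF p(2)])
    also have "\<dots> \<le> ereal (real k)"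
      using p(1) ws(2) by (simp add: awalk_cost_1)
    finally show "cayley.\<mu> (\<lambda>_. 1) a b \<le> ereal (real k)" .
  qed
next
  have "ereal (real k) \<le> cayley.\<mu> (\<lambda>_. 1) (\<phi> 0) (\<phi> x0)"
    unfolding cayley.\<mu>_def
  proof (safe intro!: INF_greatest)
    fix p assume "cayley.awalk (\<phi> 0) p (\<phi> x0)"
    from awalk_imp_word[OF this] obtain ws where
      "set ws \<subseteq> set es" "length ws = length p" "\<phi> x0 = \<phi> (sum_list ws)"
      by auto
    with lower[of ws] show "ereal (real k) \<le> ereal (cayley.awalk_cost (\<lambda>_. 1) p)"
      by (simp add: awalk_cost_1)
  qed
  also have "\<dots> \<le> cayley.digraph_diameter"
    unfolding cayley.digraph_diameter_def
    by (rule SUP_upper2[of "(\<phi> 0, \<phi> x0)"]) auto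
  finally show "ereal (real k) \<le> cayley.digraph_diameter" .
qed

lemma generate_eq_carrierI:
  assumes "\<And>x. \<exists>ws. set ws \<subseteq> set es \<and> \<phi> x = \<phi> (sum_list ws)"
  shows "generate image_group (set (map \<phi> es)) = carrier image_group"
proof
  show "generate image_group (set (map \<phi> es)) \<subseteq> carrier image_group"
    by (rule image_group.generate_incl) auto
  have "\<phi> (sum_list ws) \<in> generate image_group (set (map \<phi> es))" if "set ws \<subseteq> set es" for ws
    using that
  proof (induction ws)
    case Nil
    show ?case
      using generate.one[of image_group] by simp
  next
    case (Cons e ws)
    then have "\<phi> e \<otimes>\<^bsub>image_group\<^esub> \<phi> (sum_list ws) \<in> generate image_group (set (map \<phi> es))"
      by (intro generate.eng generate.incl[of "\<phi> e"]) auto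
    then show ?case by simp
  qed
  with assms show "carrier image_group \<subseteq> generate image_group (set (map \<phi> es))"
    unfolding carrier_image_group by (metis image_subsetI)
qed

end

section \<open>Quotients of the group of integer triples\<close>

abbreviation unit_triples :: "(int \<times> int \<times> int) list" where
  "unit_triples \<equiv> [(1, 0, 0), (0, 1, 0), (0, 0, 1)]"

lemma sum_list_unit_triples:
  assumes "set ws \<subseteq> set unit_triples"
  shows "\<exists>a b c. length ws = a + b + c \<and> sum_list ws = (int a, int b, int c)"
  using assms
proof (induction ws)
  case Nil
  show ?case by (simp add: zero_prod_def)
next
  case (Cons w ws)
  then obtain a b c where abc: "length ws = a + b + c" "sum_list ws = (int a, int b, int c)"
    by auto
  from Cons.prems have "w = (1, 0, 0) \<or> w = (0, 1, 0) \<or> w = (0, 0, 1)"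
    by auto
  then show ?case
  proof (elim disjE)
    assume "w = (1, 0, 0)"
    with abc show ?thesis
      by (intro exI[of _ "Suc a"] exI[of _ b] exI[of _ c]) simp
  next
    assume "w = (0, 1, 0)"
    with abc show ?thesis
      by (intro exI[of _ a] exI[of _ "Suc b"] exI[of _ c]) simp
  next
    assume "w = (0, 0, 1)"
    with abc show ?thesis
      by (intro exI[of _ a] exI[of _ b] exI[of _ "Suc c"]) simp
  qed
qed

lemma sum_list_replicate_prod:
  "sum_list (replicate a (1, 0, 0) @ replicate b (0, 1, 0) @ replicate c (0, 0, 1)) =
     (int a, int b, int c)"
proof -
  have "sum_list (replicate a (1, 0, 0)) = (int a, 0::int, 0::int)"
    "sum_list (replicate b (0, 1, 0)) = (0::int, int b, 0::int)"
    "sum_list (replicate c (0, 0, 1)) = (0::int, 0::int, int c)"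
    by (induction a, simp_all add: zero_prod_def, induction b, simp_all add: zero_prod_def,
        induction c, simp_all add: zero_prod_def)
  then show ?thesis by simp
qed

text \<open>In an Abelian group a word matters only through the numbers \<open>a\<close>,
  \<open>b\<close>, \<open>c\<close> of its letters of each kind, so word length becomes
  \<open>a + b + c\<close>. Composing with the injection \<open>to_nat\<close> moves the group to
  the type \<open>nat\<close> and keeps fibres and order.\<close>

lemma exists_cayley_digraph:
  fixes \<phi> :: "int \<times> int \<times> int \<Rightarrow> 'b::countable" and k :: nat
  assumes cong: "\<And>x y z. \<phi> x = \<phi> y \<Longrightarrow> \<phi> (x + z) = \<phi> (y + z)"
    and upper: "\<And>x. \<exists>a b c. a + b + c \<le> k \<and> \<phi> x = \<phi> (int a, int b, int c)"
    and lower: "\<And>a b c. \<phi> x0 = \<phi> (int a, int b, int c) \<Longrightarrow> k \<le> a + b + c"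
  shows "\<exists>(G :: nat monoid) (gs :: nat list).
    comm_group G \<and> length gs = 3 \<and> set gs \<subseteq> carrier G \<and> generate G (set gs) = carrier G \<and>
    wf_digraph.digraph_diameter (cayley_digraph G gs) = ereal (real k) \<and>
    card (verts (cayley_digraph G gs)) = card (range \<phi>)"
proof -
  interpret translation_congruence "to_nat \<circ> \<phi>" unit_triples
    by unfold_locales (auto intro: cong)
  have upper': "\<exists>ws. set ws \<subseteq> set unit_triples \<and> length ws \<le> k \<and>
    (to_nat \<circ> \<phi>) x = (to_nat \<circ> \<phi>) (sum_list ws)" for x
  proof -
    obtain a b c where abc: "a + b + c \<le> k" "\<phi> x = \<phi> (int a, int b, int c)"
      using upper by blast
    then show ?thesis
      by (intro exI[of _ "replicate a (1, 0, 0) @ replicate b (0, 1, 0) @ replicate c (0, 0, 1)"])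
        (auto simp: sum_list_replicate_prod simp del: sum_list_append)
  qed
  have lower': "k \<le> length ws"
    if "set ws \<subseteq> set unit_triples" "(to_nat \<circ> \<phi>) x0 = (to_nat \<circ> \<phi>) (sum_list ws)" for ws
    using sum_list_unit_triples[OF that(1)] that(2) lower by auto
  have "card (range (to_nat \<circ> \<phi>)) = card (range \<phi>)"
    unfolding image_comp[symmetric] by (rule card_image) (rule inj_on_subset[OF inj_to_nat], simp)
  moreover have "cayley.digraph_diameter = ereal (real k)"
    by (rule digraph_diameter_eqI[OF upper' lower'])
  moreover have
    "generate image_group (set (map (to_nat \<circ> \<phi>) unit_triples)) = carrier image_group"
    by (rule generate_eq_carrierI) (use upper' in blast)
  ultimately show ?thesis
    by (intro exI[of _ image_group] exI[of _ "map (to_nat \<circ> \<phi>) unit_triples"] conjI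
      comm_group_image_group) (simp_all add: verts_cayley[simplified])
qed

section \<open>Cyclic groups, for small diameters\<close>

text \<open>The three unit triples get the same image, so the graph is a directed cycle with
  \<open>k + 1\<close> vertices, where the last vertex is \<open>k\<close> steps from the
  first.\<close>

lemma exists_cyclic_cayley_digraph:
  "\<exists>(G :: nat monoid) (gs :: nat list).
    comm_group G \<and> length gs = 3 \<and> set gs \<subseteq> carrier G \<and> generate G (set gs) = carrier G \<and>
    wf_digraph.digraph_diameter (cayley_digraph G gs) = ereal (real k)"
proof -
  define \<phi> :: "int \<times> int \<times> int \<Rightarrow> int" where "\<phi> = (\<lambda>(x, y, z). (x + y + z) mod int (Suc k))"
  have "\<phi> (x + z) = \<phi> (y + z)" if "\<phi> x = \<phi> y" for x y z
  proof -
    obtain x1 x2 x3 y1 y2 y3 z1 z2 z3 where eqs: "x = (x1, x2, x3)" "y = (y1, y2, y3)" "z = (z1, z2, z3)"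
      by (metis prod_cases3)
    with that have "(x1 + x2 + x3 + (z1 + z2 + z3)) mod int (Suc k) =
        (y1 + y2 + y3 + (z1 + z2 + z3)) mod int (Suc k)"
      by (intro mod_add_cong[of "x1 + x2 + x3" _ "y1 + y2 + y3"]) (simp_all add: \<phi>_def)
    then show ?thesis
      by (simp add: \<phi>_def eqs algebra_simps)
  qed
  moreover have "\<exists>a b c. a + b + c \<le> k \<and> \<phi> x = \<phi> (int a, int b, int c)" for x
  proof -
    have "0 \<le> \<phi> x" "\<phi> x < int (Suc k)"
      unfolding \<phi>_def by (auto split: prod.split simp del: of_nat_Suc)
    then show ?thesis
      by (intro exI[of _ "nat (\<phi> x)"] exI[of _ 0] conjI) (auto simp: \<phi>_def)
  qed
  moreover have "k \<le> a + b + c" if "\<phi> (int k, 0, 0) = \<phi> (int a, int b, int c)" for a b c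
  proof -
    have "int k = int (a + b + c) mod int (Suc k)"
      using that by (simp add: \<phi>_def)
    also have "\<dots> \<le> int (a + b + c)"
      by (rule zmod_le_nonneg_dividend) simp
    finally show ?thesis by simp
  qed
  ultimately have "\<exists>(G :: nat monoid) (gs :: nat list).
    comm_group G \<and> length gs = 3 \<and> set gs \<subseteq> carrier G \<and> generate G (set gs) = carrier G \<and>
    wf_digraph.digraph_diameter (cayley_digraph G gs) = ereal (real k) \<and>
    card (verts (cayley_digraph G gs)) = card (range \<phi>)"
    by (rule exists_cayley_digraph)
  then show ?thesis by blast
qed

section \<open>The residues 2, 9, 35 modulo 84\<close>

lemma covering_84:
  assumes "0 \<le> r" "r < (84::int)"
  shows "\<exists>a b c. 0 \<le> a \<and> 0 \<le> b \<and> 0 \<le> c \<and> a + b + c \<le> (7::int) \<and>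
    (2 * a + 9 * b + 35 * c) mod 84 = r"
proof -
  \<comment> \<open>Position \<open>r\<close> of the table, counted from 0, holds a representation
    of the residue \<open>r\<close>.\<close>
  define reps :: "(int \<times> int \<times> int) list" where "reps =
    [(0, 0, 0), (3, 1, 2), (1, 0, 0), (4, 1, 2), (2, 0, 0), (0, 6, 1), (3, 0, 0), (0, 0, 5),
     (4, 0, 0), (0, 1, 0), (5, 0, 0), (1, 1, 0), (6, 0, 0), (2, 1, 0), (7, 0, 0), (3, 1, 0),
     (0, 1, 5), (4, 1, 0), (0, 2, 0), (5, 1, 0), (1, 2, 0), (0, 0, 3), (2, 2, 0), (1, 0, 3),
     (3, 2, 0), (2, 0, 3), (4, 2, 0), (0, 3, 0), (5, 2, 0), (1, 3, 0), (0, 1, 3), (2, 3, 0),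
     (1, 1, 3), (3, 3, 0), (2, 1, 3), (0, 0, 1), (0, 4, 0), (1, 0, 1), (1, 4, 0), (2, 0, 1),
     (2, 4, 0), (3, 0, 1), (0, 0, 6), (4, 0, 1), (0, 1, 1), (0, 5, 0), (1, 1, 1), (1, 5, 0),
     (2, 1, 1), (2, 5, 0), (3, 1, 1), (0, 1, 6), (4, 1, 1), (0, 2, 1), (0, 6, 0), (1, 2, 1),
     (0, 0, 4), (2, 2, 1), (1, 0, 4), (3, 2, 1), (2, 0, 4), (4, 2, 1), (0, 3, 1), (0, 7, 0),
     (1, 3, 1), (0, 1, 4), (2, 3, 1), (1, 1, 4), (3, 3, 1), (2, 1, 4), (0, 0, 2), (0, 4, 1),
     (1, 0, 2), (1, 4, 1), (2, 0, 2), (2, 4, 1), (3, 0, 2), (0, 0, 7), (4, 0, 2), (0, 1, 2),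
     (0, 5, 1), (1, 1, 2), (1, 5, 1), (2, 1, 2)]"
  have "map (\<lambda>(a, b, c). (2 * a + 9 * b + 35 * c) mod 84) reps = [0..83]"
    by (simp add: reps_def upto.simps)
  moreover have "r \<in> set [0..83]"
    using assms by simp
  ultimately have "r \<in> (\<lambda>(a, b, c). (2 * a + 9 * b + 35 * c) mod 84) ` set reps"
    by (metis set_map)
  moreover have "\<forall>(a, b, c) \<in> set reps. 0 \<le> a \<and> 0 \<le> b \<and> 0 \<le> c \<and> a + b + c \<le> 7"
    by (simp add: reps_def)
  ultimately show ?thesis by fast
qed

text \<open>Modulo 7 the sum \<open>a + b\<close> vanishes, so \<open>p = (a + b) / 7\<close> is 0 or 1; the formula for \<open>p\<close>
  uses \<open>1 = 4 * 2 - 7\<close>.\<close>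

lemma unique_deep_hole_84:
  fixes a b c :: int
  assumes nonneg: "0 \<le> a" "0 \<le> b" "0 \<le> c" and le: "a + b + c \<le> 7"
    and r: "(2 * a + 9 * b + 35 * c) mod 84 = 77"
  shows "a = 0 \<and> b = 0 \<and> c = 7"
proof -
  from r obtain q where q: "2 * a + 9 * b + 35 * c = 84 * q + 77"
    by (metis mult_div_mod_eq)
  define p where "p = 4 * (12 * q + 11 - b - 5 * c) - (a + b)"
  have p: "a + b = 7 * p"
    using q by (simp add: p_def)
  with nonneg le consider "p = 0" | "p = 1"
    by linarith
  then show ?thesis
  proof cases
    case 1
    with p nonneg have ab: "a = 0" "b = 0" by auto
    with q have c: "5 * c = 12 * q + 11" by simp
    \<comment> \<open>Among these, only \<open>q = 2\<close> makes \<open>12 * q + 11\<close>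
      divisible by 5, and it gives \<open>c = 7\<close>.\<close>
    with nonneg le ab have "q = 0 \<or> q = 1 \<or> q = 2" by linarith
    with c ab show ?thesis by presburger
  next
    case 2
    with p nonneg le have "a = 7 - b" "c = 0" by auto
    \<comment> \<open>No integer from 0 to 7 is congruent to 9 modulo 12, so this case is
      contradictory.\<close>
    with q have "b = 12 * q + 9" by simp
    with \<open>a = 7 - b\<close> nonneg show ?thesis by presburger
  qed
qed

section \<open>The stretched lattice\<close>

text \<open>The bounds \<open>t1 \<le> t3\<close> and \<open>t2 \<le> t3\<close> serve the upper
  estimate of the diameter. Those with 7 and 8 serve the lower one: they keep representations of 77
  by more than seven terms from being cheaper than \<open>7 * t3\<close>.\<close>

lemma exists_scaled_84_cayley_digraph:
  fixes t1 t2 t3 :: nat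
  assumes t: "0 < t1" "0 < t2" "t1 \<le> t3" "t2 \<le> t3" "7 * t3 \<le> 8 * t1" "7 * t3 \<le> 8 * t2"
  shows "\<exists>(G :: nat monoid) (gs :: nat list).
    comm_group G \<and> length gs = 3 \<and> set gs \<subseteq> carrier G \<and> generate G (set gs) = carrier G \<and>
    wf_digraph.digraph_diameter (cayley_digraph G gs) = ereal (real (t1 + t2 + 8 * t3 - 3)) \<and>
    card (verts (cayley_digraph G gs)) = 84 * t1 * t2 * t3"
proof -
  define T1 T2 T3 where T: "T1 = int t1" "T2 = int t2" "T3 = int t3"
  have pos: "T1 > 0" "T2 > 0" "T3 > 0"
    and le: "T1 \<le> T3" "T2 \<le> T3" "7 * T3 \<le> 8 * T1" "7 * T3 \<le> 8 * T2"
    using t by (auto simp: T)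
  define k where "k = t1 + t2 + 8 * t3 - 3"
  have k: "int k = T1 + T2 + 8 * T3 - 3"
    using t by (simp add: k_def T of_nat_diff)
  \<comment> \<open>The first component is the class of the quotient triple modulo \<open>L\<close>,
    so the fibres of \<open>\<phi>\<close> are the cosets of the stretched lattice.\<close>
  define \<phi> :: "int \<times> int \<times> int \<Rightarrow> int \<times> int \<times> int \<times> int" where
    "\<phi> = (\<lambda>(x, y, z). ((2 * (x div T1) + 9 * (y div T2) + 35 * (z div T3)) mod 84,
       x mod T1, y mod T2, z mod T3))"
  have cong: "\<phi> (x + z) = \<phi> (y + z)" if "\<phi> x = \<phi> y" for x y z
  proof -
    obtain x1 x2 x3 y1 y2 y3 z1 z2 z3 where
      eqs: "x = (x1, x2, x3)" "y = (y1, y2, y3)" "z = (z1, z2, z3)"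
      by (metis prod_cases3)
    define X where "X = 2 * (x1 div T1) + 9 * (x2 div T2) + 35 * (x3 div T3)"
    define Y where "Y = 2 * (y1 div T1) + 9 * (y2 div T2) + 35 * (y3 div T3)"
    from that have m: "x1 mod T1 = y1 mod T1" "x2 mod T2 = y2 mod T2" "x3 mod T3 = y3 mod T3"
      and XY: "X mod 84 = Y mod 84"
      by (simp_all add: \<phi>_def eqs X_def Y_def)
    \<comment> \<open>\<open>Z\<close> collects the quotients of \<open>z\<close> and the carries
      from adding remainders. The carries depend on remainders only, which \<open>x\<close> and
      \<open>y\<close> share, so one \<open>Z\<close> serves both.\<close>
    define Z where "Z = 2 * (z1 div T1 + (y1 mod T1 + z1 mod T1) div T1) +
      9 * (z2 div T2 + (y2 mod T2 + z2 mod T2) div T2) +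
      35 * (z3 div T3 + (y3 mod T3 + z3 mod T3) div T3)"
    have "2 * ((x1 + z1) div T1) + 9 * ((x2 + z2) div T2) + 35 * ((x3 + z3) div T3) = X + Z"
      unfolding div_add1_eq[of x1] div_add1_eq[of x2] div_add1_eq[of x3] m X_def Z_def by simp
    moreover have "2 * ((y1 + z1) div T1) + 9 * ((y2 + z2) div T2) + 35 * ((y3 + z3) div T3) = Y + Z"
      unfolding div_add1_eq[of y1] div_add1_eq[of y2] div_add1_eq[of y3] Y_def Z_def by simp
    moreover have "(X + Z) mod 84 = (Y + Z) mod 84"
      using XY by (rule mod_add_cong) simp
    ultimately show ?thesis
      using m by (simp add: \<phi>_def eqs) (metis mod_add_cong)
  qed
  have \<phi>_digits: "\<phi> (T1 * a + u, T2 * b + v, T3 * c + w) =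
      ((2 * a + 9 * b + 35 * c) mod 84, u, v, w)"
    if "0 \<le> u" "u < T1" "0 \<le> v" "v < T2" "0 \<le> w" "w < T3" for a b c u v w
    using that pos by (simp add: \<phi>_def)
  have upper: "\<exists>a b c. a + b + c \<le> k \<and> \<phi> x = \<phi> (int a, int b, int c)" for x
  proof -
    obtain r u v w where x: "\<phi> x = (r, u, v, w)" by (metis prod_cases4)
    then have bounds: "0 \<le> u" "u < T1" "0 \<le> v" "v < T2" "0 \<le> w" "w < T3" "0 \<le> r" "r < 84"
      using pos by (auto simp: \<phi>_def split: prod.splits)
    obtain a b c where abc: "0 \<le> a" "0 \<le> b" "0 \<le> c" "a + b + c \<le> 7"
      "(2 * a + 9 * b + 35 * c) mod 84 = r"
      using covering_84 bounds by blast
    have "T1 * a + T2 * b + T3 * c \<le> T3 * a + T3 * b + T3 * c"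
      using abc le by (intro add_mono mult_right_mono) auto
    also have "\<dots> = T3 * (a + b + c)"
      by (simp add: algebra_simps)
    also have "\<dots> \<le> T3 * 7"
      using abc pos by (intro mult_left_mono) auto
    finally have "(T1 * a + u) + (T2 * b + v) + (T3 * c + w) \<le> int k"
      using bounds by (simp add: k)
    moreover have "0 \<le> T1 * a + u" "0 \<le> T2 * b + v" "0 \<le> T3 * c + w"
      using abc pos bounds by auto
    ultimately show ?thesis
      using \<phi>_digits[OF bounds(1-6)] abc(5) x
      by (intro exI[of _ "nat (T1 * a + u)"] exI[of _ "nat (T2 * b + v)"]
        exI[of _ "nat (T3 * c + w)"]) simp
  qed
  \<comment> \<open>The far element has quotients \<open>(0, 0, 7)\<close>, hence residue 77, and
    the largest remainder in every coordinate.\<close>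
  have lower: "k \<le> n1 + n2 + n3"
    if "\<phi> (T1 - 1, T2 - 1, T3 * 7 + (T3 - 1)) = \<phi> (int n1, int n2, int n3)" for n1 n2 n3
  proof -
    define a b c where abc: "a = int n1 div T1" "b = int n2 div T2" "c = int n3 div T3"
    have nn: "0 \<le> a" "0 \<le> b" "0 \<le> c"
      using pos by (simp_all add: abc pos_imp_zdiv_nonneg_iff)
    have "\<phi> (int n1, int n2, int n3) = (77, T1 - 1, T2 - 1, T3 - 1)"
      using \<phi>_digits[of "T1 - 1" "T2 - 1" "T3 - 1" 0 0 7] that pos by simp
    then have r: "(2 * a + 9 * b + 35 * c) mod 84 = 77"
      and m: "int n1 mod T1 = T1 - 1" "int n2 mod T2 = T2 - 1" "int n3 mod T3 = T3 - 1"
      by (simp_all add: \<phi>_def abc)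
    have n: "int n1 = T1 * a + (T1 - 1)" "int n2 = T2 * b + (T2 - 1)" "int n3 = T3 * c + (T3 - 1)"
      using m by (metis abc mult_div_mod_eq)+
    have "7 * T3 \<le> T1 * a + T2 * b + T3 * c"
    proof (cases "a + b + c \<le> 7")
      case True
      then show ?thesis
        using unique_deep_hole_84[OF nn _ r] by simp
    next
      case False
      \<comment> \<open>Each quotient step costs at least 7/8 of \<open>T3\<close>, so eight or more
        of them cost at least \<open>7 * T3\<close>.\<close>
      then have "7 * T3 * 8 \<le> 7 * T3 * (a + b + c)"
        using pos by (intro mult_left_mono) auto
      also have "\<dots> = 7 * T3 * a + 7 * T3 * b + 7 * T3 * c"
        by (simp add: algebra_simps)
      also have "\<dots> \<le> 8 * T1 * a + 8 * T2 * b + 8 * T3 * c"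
        using nn le pos by (intro add_mono mult_right_mono) auto
      finally show ?thesis by simp
    qed
    then have "int k \<le> int (n1 + n2 + n3)"
      by (simp add: k n)
    then show ?thesis by simp
  qed
  \<comment> \<open>Residue and remainders can be prescribed independently, which gives the order of
    the group.\<close>
  have "range \<phi> = {0..<84} \<times> {0..<T1} \<times> {0..<T2} \<times> {0..<T3}"
  proof (intro equalityI subsetI)
    fix p assume "p \<in> range \<phi>"
    then show "p \<in> {0..<84::int} \<times> {0..<T1} \<times> {0..<T2} \<times> {0..<T3}"
      using pos by (auto simp: \<phi>_def)
  next
    fix p assume "p \<in> {0..<84::int} \<times> {0..<T1} \<times> {0..<T2} \<times> {0..<T3}"
    then obtain r u v w where p: "p = (r, u, v, w)" "0 \<le> r" "r < 84"
      and bounds: "0 \<le> u" "u < T1" "0 \<le> v" "v < T2" "0 \<le> w" "w < T3"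
      by auto
    obtain a b c where "(2 * a + 9 * b + 35 * c) mod 84 = r"
      using covering_84 p by blast
    then have "p = \<phi> (T1 * a + u, T2 * b + v, T3 * c + w)"
      using \<phi>_digits[OF bounds] p(1) by simp
    then show "p \<in> range \<phi>" by blast
  qed
  then have "card (range \<phi>) = 84 * t1 * t2 * t3"
    by (simp add: T)
  then show ?thesis
    using exists_cayley_digraph[of \<phi> k, OF cong upper lower] by (simp only: k_def)
qed

section \<open>Choice of the factors for a given diameter\<close>

theorem corollary18:
  shows "\<exists>f :: nat \<Rightarrow> real. f \<in> O(\<lambda>k. real k ^ 2) \<and>
    (\<forall>k :: nat. \<exists>(G :: nat monoid) (gs :: nat list).
       comm_group G \<and>
       length gs = 3 \<and> set gs \<subseteq> carrier G \<and> generate G (set gs) = carrier G \<and>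
       wf_digraph.digraph_diameter (cayley_digraph G gs) = ereal (real k) \<and>
       real (card (verts (cayley_digraph G gs))) \<ge> 0.084 * real k ^ 3 + f k)"
proof (intro exI[of _ "\<lambda>k. - 84 * real k ^ 2"] conjI allI)
  show "(\<lambda>k. - 84 * real k ^ 2) \<in> O(\<lambda>k. real k ^ 2)"
    by simp
next
  fix k :: nat
  show "\<exists>(G :: nat monoid) (gs :: nat list).
       comm_group G \<and>
       length gs = 3 \<and> set gs \<subseteq> carrier G \<and> generate G (set gs) = carrier G \<and>
       wf_digraph.digraph_diameter (cayley_digraph G gs) = ereal (real k) \<and>
       real (card (verts (cayley_digraph G gs))) \<ge> 0.084 * real k ^ 3 + - 84 * real k ^ 2"
  proof (cases "k < 1000")
    case True
    \<comment> \<open>Since 84 is 0.084 times 1000, the claimed bound is not positive below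
      1000.\<close>
    have "0.084 * real k ^ 3 + - 84 * real k ^ 2 = real k ^ 2 * (0.084 * real k - 84)"
      by (simp add: power3_eq_cube power2_eq_square algebra_simps)
    also have "\<dots> \<le> 0"
      using True by (intro mult_nonneg_nonpos) auto
    finally have "0.084 * real k ^ 3 + - 84 * real k ^ 2 \<le> real n" for n
      using of_nat_0_le_iff[of n] by linarith
    then show ?thesis
      using exists_cyclic_cayley_digraph[of k] by blast
  next
    case False
    \<comment> \<open>Three equal factors \<open>a\<close> would give diameter
      \<open>10 * a - 3\<close>, so \<open>a\<close> is \<open>(k + 3) / 10\<close> rounded up. Then
      \<open>t\<close> is the solution of \<open>t + 9 * a - 3 = k\<close>, and the rounding costs
      it at most 9 against \<open>a\<close>.\<close>
    define a where "a = (k + 12) div 10"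
    define t where "t = k + 3 - 9 * a"
    have a: "10 * a \<le> k + 12" "k + 3 \<le> 10 * a"
      by (auto simp: a_def)
    then have t: "0 < t" "t \<le> a" "7 * a \<le> 8 * t" "t + a + 8 * a - 3 = k" "a \<le> t + 9"
      using False by (auto simp: t_def)
    \<comment> \<open>The right side expands to the same cubic term minus only 7.56 times the square
      of \<open>k\<close>; it uses that \<open>a\<close> is at least \<open>k / 10\<close> and
      \<open>t\<close> at least \<open>a - 9\<close>.\<close>
    have "0.084 * real k ^ 3 - 84 * real k ^ 2 \<le> 84 * ((real k / 10 - 9) * (real k / 10) * (real k / 10))"
      by (simp add: power3_eq_cube power2_eq_square algebra_simps)
    also have "\<dots> \<le> 84 * (real t * real a * real a)"
      using a t False by (intro mult_left_mono mult_mono) auto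
    finally have "0.084 * real k ^ 3 + - 84 * real k ^ 2 \<le> real (84 * t * a * a)"
      by simp
    moreover have "\<exists>(G :: nat monoid) (gs :: nat list).
      comm_group G \<and> length gs = 3 \<and> set gs \<subseteq> carrier G \<and> generate G (set gs) = carrier G \<and>
      wf_digraph.digraph_diameter (cayley_digraph G gs) = ereal (real k) \<and>
      card (verts (cayley_digraph G gs)) = 84 * t * a * a"
      using exists_scaled_84_cayley_digraph[of t a a] t(1-3) unfolding t(4) by simp
    ultimately show ?thesis
      by metis
  qed
qed

end
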